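(* Let $X$ be a locally compact Hausdorff space. Then $CL(X)$ (with the Fell topology and the operation $\cup$) and $(E(\Gamma(X)),\tau_{hco})$ are topologically isomorphic inverse semigroups. In particular, $E(\Gamma(X))$ is compact with respect to $\tau_{hco}$.
   Context: $\Gamma(X)$ is the inverse semigroup of all homeomorphisms $f:\mathrm{dom}(f)\to\mathrm{im}(f)$ between open subsets of $X$, under composition of partial maps: $\mathrm{dom}(f\circ g)=\{x\in\mathrm{dom}(g): g(x)\in\mathrm{dom}(f)\}$. $E(\Gamma(X))$ is its set of idempotents, with the subspace topology. Topologically isomorphic means there is a semigroup isomorphism that is a homeomorphism. For $K\subseteq X$ compact and $V\subseteq X$ open, $\langle K;V\rangle=\{f\in\Gamma(X): K\subseteq\mathrm{dom}(f),\ f(K)\subseteq V\}$ and $\langle K;V\rangle^{-1}=\{f\in\Gamma(X): f^{-1}\in\langle K;V\rangle\}$; $\tau_{ico}$ is the topology on $\Gamma(X)$ generated by all these sets. $CL(X)$ is the set of closed subsets of $X$ (including $\emptyset$) with the Fell topology, whose subbasis consists of $V^-=\{A: A\cap V\neq\emptyset\}$ for $V$ open and $W^+=\{A: A\subseteq W\}$ for $W$ open with $X\setminus W$ compact. Let $\mathsf{D}(f)=X\setminus\mathrm{dom}(f)$ and $\mathsf{I}(f)=X\setminus\mathrm{im}(f)$. The topology $\tau_{hco}$ on $\Gamma(X)$ is generated by $\tau_{ico}$ together with the sets $\mathsf{D}^{-1}(U)$ and $\mathsf{I}^{-1}(U)$ for $U$ Fell-open in $CL(X)$. *)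

theory Defs
  imports "HOL-Analysis.Analysis" "HOL-Algebra.Group"
begin

text \<open>
  A partial map of X is a term of type \<open>'a \<rightharpoonup> 'a\<close>; the library composition \<open>f \<circ>\<^sub>m g\<close>
  has domain \<open>{x \<in> dom g. the (g x) \<in> dom f}\<close>.
\<close>

definition partial_homeos :: "'a topology \<Rightarrow> ('a \<rightharpoonup> 'a) set" where
  "partial_homeos X =
    {f. openin X (dom f) \<and> openin X (ran f) \<and>
        homeomorphic_map (subtopology X (dom f)) (subtopology X (ran f)) (\<lambda>x. the (f x))}"

definition partial_inverse :: "('a \<rightharpoonup> 'b) \<Rightarrow> ('b \<rightharpoonup> 'a)" where
  "partial_inverse f = (\<lambda>y. if y \<in> ran f then Some (THE x. f x = Some y) else None)"

text \<open>
  Semigroups are represented by the \<open>monoid\<close> record. Only \<open>carrier\<close> and \<open>mult\<close> are relevant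
  below: \<open>hom\<close> and \<open>iso\<close> do not mention the \<open>one\<close> field.
\<close>

definition inverse_semigroup :: "('a, 'm) monoid_scheme \<Rightarrow> bool" where
  "inverse_semigroup S \<longleftrightarrow>
    (\<forall>x \<in> carrier S. \<forall>y \<in> carrier S. x \<otimes>\<^bsub>S\<^esub> y \<in> carrier S) \<and>
    (\<forall>x \<in> carrier S. \<forall>y \<in> carrier S. \<forall>z \<in> carrier S.
        (x \<otimes>\<^bsub>S\<^esub> y) \<otimes>\<^bsub>S\<^esub> z = x \<otimes>\<^bsub>S\<^esub> (y \<otimes>\<^bsub>S\<^esub> z)) \<and>
    (\<forall>x \<in> carrier S. \<exists>!y. y \<in> carrier S \<and>
        (x \<otimes>\<^bsub>S\<^esub> y) \<otimes>\<^bsub>S\<^esub> x = x \<and> (y \<otimes>\<^bsub>S\<^esub> x) \<otimes>\<^bsub>S\<^esub> y = y)"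

definition idempotents :: "('a, 'm) monoid_scheme \<Rightarrow> 'a set" where
  "idempotents S = {e \<in> carrier S. e \<otimes>\<^bsub>S\<^esub> e = e}"

definition topologically_isomorphic ::
    "('a, 'm) monoid_scheme \<Rightarrow> 'a topology \<Rightarrow> ('b, 'n) monoid_scheme \<Rightarrow> 'b topology \<Rightarrow> bool" where
  "topologically_isomorphic S T S' T' \<longleftrightarrow> (\<exists>h \<in> iso S S'. homeomorphic_map T T' h)"

definition Homeo_Gamma :: "'a topology \<Rightarrow> ('a \<rightharpoonup> 'a) monoid" where
  "Homeo_Gamma X = \<lparr>carrier = partial_homeos X, mult = (\<circ>\<^sub>m), one = Some |` topspace X\<rparr>"

definition E_Gamma :: "'a topology \<Rightarrow> ('a \<rightharpoonup> 'a) monoid" where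
  "E_Gamma X = (Homeo_Gamma X)\<lparr>carrier := idempotents (Homeo_Gamma X)\<rparr>"

definition co_set :: "'a topology \<Rightarrow> 'a set \<Rightarrow> 'a set \<Rightarrow> ('a \<rightharpoonup> 'a) set" where
  "co_set X K V = {f \<in> carrier (Homeo_Gamma X). K \<subseteq> dom f \<and> (\<lambda>x. the (f x)) ` K \<subseteq> V}"

definition co_inv_set :: "'a topology \<Rightarrow> 'a set \<Rightarrow> 'a set \<Rightarrow> ('a \<rightharpoonup> 'a) set" where
  "co_inv_set X K V = {f \<in> carrier (Homeo_Gamma X). partial_inverse f \<in> co_set X K V}"

definition tau_ico :: "'a topology \<Rightarrow> ('a \<rightharpoonup> 'a) topology" where
  "tau_ico X = topology_generated_by
    ({co_set X K V |K V. compactin X K \<and> openin X V} \<union>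
     {co_inv_set X K V |K V. compactin X K \<and> openin X V})"

definition CL :: "'a topology \<Rightarrow> 'a set monoid" where
  "CL X = \<lparr>carrier = {A. closedin X A}, mult = (\<union>), one = {}\<rparr>"

definition fell_topology :: "'a topology \<Rightarrow> 'a set topology" where
  "fell_topology X = topology_generated_by
    ({{A \<in> carrier (CL X). A \<inter> V \<noteq> {}} |V. openin X V} \<union>
     {{A \<in> carrier (CL X). A \<subseteq> W} |W. openin X W \<and> compactin X (topspace X - W)})"

definition im_hole :: "'a topology \<Rightarrow> ('a \<rightharpoonup> 'a) \<Rightarrow> 'a set" where
  "im_hole X f = topspace X - ran f"

definition dom_hole :: "'a topology \<Rightarrow> ('a \<rightharpoonup> 'a) \<Rightarrow> 'a set" where
  "dom_hole X f = topspace X - dom f"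

definition tau_hco :: "'a topology \<Rightarrow> ('a \<rightharpoonup> 'a) topology" where
  "tau_hco X = topology_generated_by
    ({U. openin (tau_ico X) U} \<union>
     {{f \<in> carrier (Homeo_Gamma X). dom_hole X f \<in> U} |U. openin (fell_topology X) U} \<union>
     {{f \<in> carrier (Homeo_Gamma X). im_hole X f \<in> U} |U. openin (fell_topology X) U})"

lemma Union_eq_carrierI:
  assumes "B0 \<in> S" and "B0 = C" and "\<And>B. B \<in> S \<Longrightarrow> B \<subseteq> C"
  shows "\<Union>S = C"
  using assms by blast

lemma topspace_fell_topology: "topspace (fell_topology X) = carrier (CL X)"
  unfolding fell_topology_def topology_generated_by_topspace
proof (rule Union_eq_carrierI)
  show "{A \<in> carrier (CL X). A \<subseteq> topspace X} \<in>
      {{A \<in> carrier (CL X). A \<inter> V \<noteq> {}} |V. openin X V} \<union>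
      {{A \<in> carrier (CL X). A \<subseteq> W} |W. openin X W \<and> compactin X (topspace X - W)}"
    by (rule UnI2, rule CollectI, rule exI[of _ "topspace X"]) simp
  show "{A \<in> carrier (CL X). A \<subseteq> topspace X} = carrier (CL X)"
    by (auto simp: CL_def dest: closedin_subset)
qed auto

lemma topspace_tau_ico: "topspace (tau_ico X) = carrier (Homeo_Gamma X)"
  unfolding tau_ico_def topology_generated_by_topspace
proof (rule Union_eq_carrierI)
  show "co_set X {} {} \<in>
      {co_set X K V |K V. compactin X K \<and> openin X V} \<union>
      {co_inv_set X K V |K V. compactin X K \<and> openin X V}"
    by (rule UnI1, rule CollectI, rule exI[of _ "{}"], rule exI[of _ "{}"]) simp
  show "co_set X {} {} = carrier (Homeo_Gamma X)"
    by (simp add: co_set_def)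
qed (auto simp: co_set_def co_inv_set_def)

lemma topspace_tau_hco: "topspace (tau_hco X) = carrier (Homeo_Gamma X)"
  unfolding tau_hco_def topology_generated_by_topspace
proof (rule Union_eq_carrierI)
  show "topspace (tau_ico X) \<in>
      {U. openin (tau_ico X) U} \<union>
      {{f \<in> carrier (Homeo_Gamma X). dom_hole X f \<in> U} |U. openin (fell_topology X) U} \<union>
      {{f \<in> carrier (Homeo_Gamma X). im_hole X f \<in> U} |U. openin (fell_topology X) U}"
    by simp
  show "topspace (tau_ico X) = carrier (Homeo_Gamma X)"
    by (rule topspace_tau_ico)
  show "B \<subseteq> carrier (Homeo_Gamma X)"
    if "B \<in> {U. openin (tau_ico X) U} \<union>
      {{f \<in> carrier (Homeo_Gamma X). dom_hole X f \<in> U} |U. openin (fell_topology X) U} \<union>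
      {{f \<in> carrier (Homeo_Gamma X). im_hole X f \<in> U} |U. openin (fell_topology X) U}" for B
    using that openin_subset[of "tau_ico X" B] unfolding topspace_tau_ico by auto
qed

end

theory Submission
  imports Defs
begin

text \<open>
  An idempotent partial homeomorphism is the identity of an open set: where \<open>f x = y\<close>,
  idempotency gives \<open>f y = y\<close>, so \<open>x = y\<close> by injectivity. It is therefore determined by its hole,
  the closed complement of its domain, and every closed set is such a hole. Composing two partial
  identities intersects their domains, which unites their holes. So the map
  \<open>hole_idempotent X\<close>, taking a closed set to the idempotent with that hole, is an
  isomorphism from closed sets under union, and both structures are semilattices.

  The inverse of this map is the restriction of \<open>dom_hole X\<close>, which is continuous because the
  preimages of Fell-open sets under it are among the generators of \<open>tau_hco X\<close>. For the continuity
  of the map itself, an idempotent has equal domain and image holes, so the generators that come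
  from the Fell topology pull back to the given Fell-open sets. A compact-open generator given by
  \<open>K\<close> and \<open>V\<close> pulls back to the closed sets disjoint from \<open>K\<close> if \<open>K \<subseteq> V\<close> and to the
  empty set otherwise. The former is a Fell-subbasic set since the compact set \<open>K\<close>
  is closed in a Hausdorff space. Thus the map is a homeomorphism.

  Compactness transfers along this homeomorphism from the Fell topology, where it follows from
  the Alexander subbase theorem (\<open>compact_space_fell_topology\<close>).
\<close>

section \<open>Semilattices as inverse semigroups\<close>

text \<open>
  In a semilattice \<open>xyx = xy = yxy\<close>, so mutually inverse elements are equal and the only
  inverse of an element is itself.
\<close>

lemma commutative_band_inverse_semigroup:
  assumes closed: "\<And>x y. \<lbrakk>x \<in> carrier S; y \<in> carrier S\<rbrakk> \<Longrightarrow> x \<otimes>\<^bsub>S\<^esub> y \<in> carrier S"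
    and assoc: "\<And>x y z. \<lbrakk>x \<in> carrier S; y \<in> carrier S; z \<in> carrier S\<rbrakk>
      \<Longrightarrow> (x \<otimes>\<^bsub>S\<^esub> y) \<otimes>\<^bsub>S\<^esub> z = x \<otimes>\<^bsub>S\<^esub> (y \<otimes>\<^bsub>S\<^esub> z)"
    and comm: "\<And>x y. \<lbrakk>x \<in> carrier S; y \<in> carrier S\<rbrakk> \<Longrightarrow> x \<otimes>\<^bsub>S\<^esub> y = y \<otimes>\<^bsub>S\<^esub> x"
    and idem: "\<And>x. x \<in> carrier S \<Longrightarrow> x \<otimes>\<^bsub>S\<^esub> x = x"
  shows "inverse_semigroup S"
proof -
  have absorb: "(x \<otimes>\<^bsub>S\<^esub> y) \<otimes>\<^bsub>S\<^esub> x = x \<otimes>\<^bsub>S\<^esub> y"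
    if x: "x \<in> carrier S" and y: "y \<in> carrier S" for x y
  proof -
    have "(x \<otimes>\<^bsub>S\<^esub> y) \<otimes>\<^bsub>S\<^esub> x = x \<otimes>\<^bsub>S\<^esub> (x \<otimes>\<^bsub>S\<^esub> y)"
      using closed comm x y by simp
    also have "\<dots> = x \<otimes>\<^bsub>S\<^esub> y"
      using assoc[symmetric] idem x y by simp
    finally show ?thesis .
  qed
  have unique_inverse: "\<exists>!y. y \<in> carrier S \<and> (x \<otimes>\<^bsub>S\<^esub> y) \<otimes>\<^bsub>S\<^esub> x = x \<and> (y \<otimes>\<^bsub>S\<^esub> x) \<otimes>\<^bsub>S\<^esub> y = y"
    if x: "x \<in> carrier S" for x
  proof (rule ex1I[of _ x])
    show "x \<in> carrier S \<and> (x \<otimes>\<^bsub>S\<^esub> x) \<otimes>\<^bsub>S\<^esub> x = x \<and> (x \<otimes>\<^bsub>S\<^esub> x) \<otimes>\<^bsub>S\<^esub> x = x"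
      using idem x by simp
    show "y = x"
      if "y \<in> carrier S \<and> (x \<otimes>\<^bsub>S\<^esub> y) \<otimes>\<^bsub>S\<^esub> x = x \<and> (y \<otimes>\<^bsub>S\<^esub> x) \<otimes>\<^bsub>S\<^esub> y = y" for y
      using that absorb[of x y] absorb[of y x] comm[of x y] x by simp
  qed
  show ?thesis
    unfolding inverse_semigroup_def
    by (intro conjI ballI; rule closed assoc unique_inverse; assumption)
qed

section \<open>The idempotent partial homeomorphisms\<close>

lemma dom_restrict_Some [simp]: "dom (Some |` U) = U"
  by (auto simp: restrict_map_def split: if_splits)

lemma ran_restrict_Some [simp]: "ran (Some |` U) = U"
  by (auto simp: restrict_map_def ran_def)

lemma restrict_Some_comp: "(Some |` U) \<circ>\<^sub>m (Some |` V) = Some |` (U \<inter> V)"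
  by (rule ext) (auto simp: map_comp_def restrict_map_def)

lemma partial_inverse_restrict_Some [simp]: "partial_inverse (Some |` U) = Some |` U"
proof
  show "partial_inverse (Some |` U) y = (Some |` U) y" for y
    by (auto simp: partial_inverse_def restrict_map_def ran_def intro!: the_equality
        split: if_splits)
qed

lemma restrict_Some_partial_homeo:
  assumes "openin X U"
  shows "Some |` U \<in> partial_homeos X"
proof -
  have "homeomorphic_map (subtopology X U) (subtopology X U) (\<lambda>x. the ((Some |` U) x))"
    by (rule homeomorphic_map_eq[OF homeomorphic_map_id[THEN iffD2, OF refl]])
      (simp add: restrict_map_def)
  then show ?thesis
    using assms by (simp add: partial_homeos_def)
qed

text \<open>
  Injectivity forces \<open>y = x\<close> whenever \<open>f x = y\<close>, because idempotency makes \<open>y\<close> a fixed point.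
\<close>

lemma idempotent_partial_homeo:
  assumes f: "f \<in> partial_homeos X" and idem: "f \<circ>\<^sub>m f = f"
  shows "f = Some |` dom f"
proof
  have inj: "inj_on (\<lambda>x. the (f x)) (dom f)"
    using f openin_subset[of X "dom f"]
    by (auto simp: partial_homeos_def dest!: homeomorphic_imp_injective_map
        simp: Int_absorb1)
  show "f x = (Some |` dom f) x" for x
  proof (cases "f x")
    case None
    then show ?thesis by (simp add: restrict_map_def domIff)
  next
    case (Some y)
    have "f y = Some y"
      using fun_cong[OF idem, of x] Some by simp
    then have "y = x"
      using inj_onD[OF inj, of y x] Some by auto
    then show ?thesis
      using Some by (simp add: restrict_map_def domIff)
  qed
qed

lemma idempotents_Homeo_Gamma:
  "idempotents (Homeo_Gamma X) = {Some |` U |U. openin X U}"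
proof (intro equalityI subsetI)
  fix f assume "f \<in> idempotents (Homeo_Gamma X)"
  then have "f \<in> partial_homeos X" "f \<circ>\<^sub>m f = f"
    by (auto simp: idempotents_def Homeo_Gamma_def)
  then have "f = Some |` dom f" "openin X (dom f)"
    by (rule idempotent_partial_homeo)
      (use \<open>f \<in> partial_homeos X\<close> in \<open>simp add: partial_homeos_def\<close>)
  then show "f \<in> {Some |` U |U. openin X U}"
    by blast
qed (auto simp: idempotents_def Homeo_Gamma_def restrict_Some_partial_homeo restrict_Some_comp)

lemma inverse_semigroup_CL: "inverse_semigroup (CL X)"
  by (rule commutative_band_inverse_semigroup) (auto simp: CL_def)

lemma inverse_semigroup_E_Gamma: "inverse_semigroup (E_Gamma X)"
proof -
  have carrier: "carrier (E_Gamma X) = {Some |` U |U. openin X U}"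
    by (simp add: E_Gamma_def idempotents_Homeo_Gamma)
  have mult: "mult (E_Gamma X) = (\<circ>\<^sub>m)"
    by (simp add: E_Gamma_def Homeo_Gamma_def)
  show ?thesis
    by (rule commutative_band_inverse_semigroup)
      (auto simp: carrier mult restrict_Some_comp Int_ac)
qed

section \<open>The algebraic isomorphism\<close>

definition hole_idempotent :: "'a topology \<Rightarrow> 'a set \<Rightarrow> ('a \<rightharpoonup> 'a)" where
  "hole_idempotent X A = Some |` (topspace X - A)"

lemma hole_idempotent_carrier:
  "closedin X A \<Longrightarrow> hole_idempotent X A \<in> carrier (Homeo_Gamma X)"
  by (simp add: hole_idempotent_def Homeo_Gamma_def restrict_Some_partial_homeo openin_diff)

lemma dom_hole_hole_idempotent [simp]: "closedin X A \<Longrightarrow> dom_hole X (hole_idempotent X A) = A"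
  using closedin_subset[of X A] by (auto simp: dom_hole_def hole_idempotent_def)

lemma im_hole_hole_idempotent [simp]: "closedin X A \<Longrightarrow> im_hole X (hole_idempotent X A) = A"
  using closedin_subset[of X A] by (auto simp: im_hole_def hole_idempotent_def)

lemma hole_idempotent_image:
  "hole_idempotent X ` {A. closedin X A} = idempotents (Homeo_Gamma X)"
proof (intro equalityI subsetI)
  fix f assume "f \<in> idempotents (Homeo_Gamma X)"
  then obtain U where U: "openin X U" "f = Some |` U"
    by (auto simp: idempotents_Homeo_Gamma)
  then have "f = hole_idempotent X (topspace X - U)"
    using openin_subset[of X U] by (simp add: hole_idempotent_def double_diff)
  then show "f \<in> hole_idempotent X ` {A. closedin X A}"
    using U by blast
qed (auto simp: idempotents_Homeo_Gamma hole_idempotent_def)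

lemma hole_idempotent_bij:
  "bij_betw (hole_idempotent X) {A. closedin X A} (idempotents (Homeo_Gamma X))"
  unfolding bij_betw_def
  by (metis (mono_tags, lifting) dom_hole_hole_idempotent hole_idempotent_image inj_onI
      mem_Collect_eq)

lemma hole_idempotent_iso: "hole_idempotent X \<in> iso (CL X) (E_Gamma X)"
proof (rule isoI)
  show "bij_betw (hole_idempotent X) (carrier (CL X)) (carrier (E_Gamma X))"
    using hole_idempotent_bij by (simp add: CL_def E_Gamma_def)
  have "hole_idempotent X (A \<union> B) = hole_idempotent X A \<circ>\<^sub>m hole_idempotent X B" for A B
    by (simp add: hole_idempotent_def restrict_Some_comp Diff_Un)
  then show "hole_idempotent X \<in> hom (CL X) (E_Gamma X)"
    using hole_idempotent_image[of X]
    by (auto simp: hom_def CL_def E_Gamma_def Homeo_Gamma_def)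
qed

section \<open>The two topologies\<close>

text \<open>
  A partial identity moves no point, so the target \<open>V\<close> restricts only \<open>K\<close>, not \<open>A\<close>.
\<close>

lemma hole_idempotent_co_set:
  assumes "closedin X A" "K \<subseteq> topspace X"
  shows "hole_idempotent X A \<in> co_set X K V \<longleftrightarrow> K \<subseteq> V \<and> A \<inter> K = {}"
proof -
  have "(\<lambda>x. the ((Some |` (topspace X - A)) x)) ` K = K" if "K \<subseteq> topspace X - A"
    using that by (force simp: restrict_map_def)
  then show ?thesis
    using assms hole_idempotent_carrier[of X A]
    by (auto simp: co_set_def hole_idempotent_def)
qed

text \<open>
  A partial identity is its own inverse, so the generators with inverses add no further condition.
\<close>

lemma hole_idempotent_co_inv_set:
  assumes "closedin X A"
  shows "hole_idempotent X A \<in> co_inv_set X K V \<longleftrightarrow> hole_idempotent X A \<in> co_set X K V"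
  using hole_idempotent_carrier[OF assms] by (simp add: co_inv_set_def hole_idempotent_def)

text \<open>
  Avoiding \<open>K\<close> means being contained in the complement of \<open>K\<close>, which is a subbasic condition
  because that complement is open, \<open>K\<close> being closed in a Hausdorff space, and has compact
  complement \<open>K\<close>.
\<close>

lemma openin_fell_avoiding_compact:
  assumes "Hausdorff_space X" "compactin X K"
  shows "openin (fell_topology X) {A \<in> carrier (CL X). A \<inter> K = {}}"
proof -
  have K: "K \<subseteq> topspace X" "openin X (topspace X - K)"
    using assms by (auto simp: compactin_subset_topspace compactin_imp_closedin)
  have "{A \<in> carrier (CL X). A \<inter> K = {}} = {A \<in> carrier (CL X). A \<subseteq> topspace X - K}"
    by (auto simp: CL_def dest: closedin_subset)
  moreover have "openin (fell_topology X) {A \<in> carrier (CL X). A \<subseteq> topspace X - K}"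
    unfolding fell_topology_def
    by (rule topology_generated_by_Basis)
      (use assms K in \<open>auto simp: double_diff intro!: exI[of _ "topspace X - K"]\<close>)
  ultimately show ?thesis by simp
qed

lemma continuous_map_hole_idempotent_ico:
  assumes "Hausdorff_space X"
  shows "continuous_map (fell_topology X) (tau_ico X) (hole_idempotent X)"
  unfolding tau_ico_def
proof (rule continuous_on_generated_topo)
  let ?preim = "\<lambda>S. hole_idempotent X -` S \<inter> topspace (fell_topology X)"
  have co: "openin (fell_topology X) (?preim (co_set X K V))" if K: "compactin X K" for K V
  proof -
    have "?preim (co_set X K V) = (if K \<subseteq> V then {A \<in> carrier (CL X). A \<inter> K = {}} else {})"
      using hole_idempotent_co_set[OF _ compactin_subset_topspace[OF K], of _ V]
      by (auto simp: topspace_fell_topology CL_def)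
    then show ?thesis
      using openin_fell_avoiding_compact[OF assms K] by simp
  qed
  have co_inv: "?preim (co_inv_set X K V) = ?preim (co_set X K V)" for K V
    by (auto simp: topspace_fell_topology CL_def hole_idempotent_co_inv_set)
  fix S
  assume "S \<in> {co_set X K V |K V. compactin X K \<and> openin X V} \<union>
      {co_inv_set X K V |K V. compactin X K \<and> openin X V}"
  then show "openin (fell_topology X) (?preim S)"
    using co co_inv by auto
next
  show "hole_idempotent X ` topspace (fell_topology X) \<subseteq>
      \<Union> ({co_set X K V |K V. compactin X K \<and> openin X V} \<union>
         {co_inv_set X K V |K V. compactin X K \<and> openin X V})"
    using topspace_tau_ico[of X] hole_idempotent_carrier[of X]
    unfolding tau_ico_def topology_generated_by_topspace
    by (auto simp: topspace_fell_topology CL_def)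
qed

lemma continuous_map_hole_idempotent_hco:
  assumes "Hausdorff_space X"
  shows "continuous_map (fell_topology X) (tau_hco X) (hole_idempotent X)"
  unfolding tau_hco_def
proof (rule continuous_on_generated_topo)
  let ?preim = "\<lambda>S. hole_idempotent X -` S \<inter> topspace (fell_topology X)"
  have ico: "openin (fell_topology X) (?preim S)" if "openin (tau_ico X) S" for S
    using openin_continuous_map_preimage[OF continuous_map_hole_idempotent_ico[OF assms] that]
    by (simp add: vimage_def Int_def conj_commute)
  have holes: "?preim {f \<in> carrier (Homeo_Gamma X). dom_hole X f \<in> U} = U"
      "?preim {f \<in> carrier (Homeo_Gamma X). im_hole X f \<in> U} = U"
    if "openin (fell_topology X) U" for U
    using openin_subset[OF that] hole_idempotent_carrier[of X]
    by (auto simp: topspace_fell_topology CL_def)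
  fix S
  assume "S \<in> {U. openin (tau_ico X) U} \<union>
     {{f \<in> carrier (Homeo_Gamma X). dom_hole X f \<in> U} |U. openin (fell_topology X) U} \<union>
     {{f \<in> carrier (Homeo_Gamma X). im_hole X f \<in> U} |U. openin (fell_topology X) U}"
  then show "openin (fell_topology X) (?preim S)"
    using ico holes by auto
next
  show "hole_idempotent X ` topspace (fell_topology X) \<subseteq>
      \<Union> ({U. openin (tau_ico X) U} \<union>
     {{f \<in> carrier (Homeo_Gamma X). dom_hole X f \<in> U} |U. openin (fell_topology X) U} \<union>
     {{f \<in> carrier (Homeo_Gamma X). im_hole X f \<in> U} |U. openin (fell_topology X) U})"
    using topspace_tau_hco[of X] hole_idempotent_carrier[of X]
    unfolding tau_hco_def topology_generated_by_topspace
    by (auto simp: topspace_fell_topology CL_def)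
qed

lemma continuous_map_dom_hole: "continuous_map (tau_hco X) (fell_topology X) (dom_hole X)"
  unfolding continuous_map_def
proof (intro conjI allI impI)
  show "dom_hole X \<in> topspace (tau_hco X) \<rightarrow> topspace (fell_topology X)"
    by (auto simp: topspace_tau_hco topspace_fell_topology CL_def dom_hole_def Homeo_Gamma_def
        partial_homeos_def closedin_diff)
  show "openin (tau_hco X) {f \<in> topspace (tau_hco X). dom_hole X f \<in> U}"
    if "openin (fell_topology X) U" for U
    unfolding topspace_tau_hco unfolding tau_hco_def
    by (rule topology_generated_by_Basis) (use that in blast)
qed

lemma hole_idempotent_homeomorphic_map:
  assumes "Hausdorff_space X"
  shows "homeomorphic_map (fell_topology X)
    (subtopology (tau_hco X) (idempotents (Homeo_Gamma X))) (hole_idempotent X)"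
proof -
  have "homeomorphic_maps (fell_topology X)
    (subtopology (tau_hco X) (idempotents (Homeo_Gamma X))) (hole_idempotent X) (dom_hole X)"
    unfolding homeomorphic_maps_def
  proof (intro conjI ballI)
    show "continuous_map (fell_topology X)
        (subtopology (tau_hco X) (idempotents (Homeo_Gamma X))) (hole_idempotent X)"
      using continuous_map_hole_idempotent_hco[OF assms] hole_idempotent_image[of X]
      by (auto simp: continuous_map_in_subtopology topspace_fell_topology CL_def)
    show "continuous_map (subtopology (tau_hco X) (idempotents (Homeo_Gamma X)))
        (fell_topology X) (dom_hole X)"
      by (rule continuous_map_from_subtopology[OF continuous_map_dom_hole])
    show "dom_hole X (hole_idempotent X A) = A" if "A \<in> topspace (fell_topology X)" for A
      using that by (simp add: topspace_fell_topology CL_def)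
    show "hole_idempotent X (dom_hole X f) = f"
      if f: "f \<in> topspace (subtopology (tau_hco X) (idempotents (Homeo_Gamma X)))" for f
    proof -
      obtain A where "closedin X A" "f = hole_idempotent X A"
        using f by (auto simp flip: hole_idempotent_image)
      then show ?thesis by simp
    qed
  qed
  then show ?thesis
    by (auto simp: homeomorphic_map_maps)
qed

section \<open>Compactness\<close>

text \<open>
  The Alexander subbase theorem is stated for topologies built from finite intersections and
  arbitrary unions of subbasic sets, so it has to be matched with \<open>topology_generated_by\<close>.
\<close>

lemma topology_generated_by_eq_subbase:
  "topology_generated_by \<B> =
    topology (arbitrary union_of (finite intersection_of (\<lambda>x. x \<in> \<B>) relative_to \<Union>\<B>))"
  (is "?G = ?T")
proof -
  have "openin ?T S" if "openin ?G S" for S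
    using openin_topology_generated_by[OF that]
  proof (rule generate_topology_on_coarsest[OF istopology_openin, rotated])
    show "openin ?T B" if "B \<in> \<B>" for B
      unfolding openin_subbase
      by (rule arbitrary_union_of_inc, rule relative_to_subset_inc)
        (use that in \<open>auto intro: finite_intersection_of_inc\<close>)
  qed
  moreover have "openin ?G S" if "openin ?T S" for S
    by (rule minimal_topology_subbase[OF _ _ that])
      (auto simp: topology_generated_by_Basis simp flip: topology_generated_by_topspace)
  ultimately show ?thesis
    by (auto simp: topology_eq)
qed

lemma compact_space_topology_generated_by:
  assumes "\<And>C. \<lbrakk>C \<subseteq> \<B>; \<Union>C = \<Union>\<B>\<rbrakk> \<Longrightarrow> \<exists>C'. finite C' \<and> C' \<subseteq> C \<and> \<Union>C' = \<Union>\<B>"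
  shows "compact_space (topology_generated_by \<B>)"
  by (rule Alexander_subbase[OF topology_generated_by_eq_subbase[symmetric]])
    (use assms in simp)

text \<open>
  Given a cover by subbasic sets, test it on the closed set \<open>A\<close> left over by all \<open>V\<close> whose
  hit-sets occur in the cover. As \<open>A\<close> hits none of them, it lies in a miss-set of the cover,
  given by some \<open>W\<close>; so the compact complement of \<open>W\<close> is covered by the \<open>V\<close>, hence by finitely
  many of them. A closed set is either contained in \<open>W\<close> or hits one of these finitely many \<open>V\<close>.
\<close>

theorem compact_space_fell_topology: "compact_space (fell_topology X)"
proof -
  let ?hit = "\<lambda>V. {A \<in> carrier (CL X). A \<inter> V \<noteq> {}}"
  let ?miss = "\<lambda>W. {A \<in> carrier (CL X). A \<subseteq> W}"
  let ?B = "{?hit V |V. openin X V} \<union> {?miss W |W. openin X W \<and> compactin X (topspace X - W)}"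
  have UB: "\<Union> ?B = carrier (CL X)"
    using topspace_fell_topology[of X]
    unfolding fell_topology_def topology_generated_by_topspace .
  have "\<exists>C'. finite C' \<and> C' \<subseteq> C \<and> \<Union> C' = \<Union> ?B" if C: "C \<subseteq> ?B" and cover: "\<Union> C = \<Union> ?B" for C
  proof -
    define \<V> where "\<V> = {V. openin X V \<and> ?hit V \<in> C}"
    define A where "A = topspace X - \<Union> \<V>"
    have A: "A \<in> carrier (CL X)"
      by (auto simp: CL_def A_def \<V>_def)
    then obtain S where S: "S \<in> C" "A \<in> S"
      using cover unfolding UB by blast
    have no_hit: False if "openin X V" "S = ?hit V" for V
    proof -
      have "V \<in> \<V>"
        using that S(1) by (simp add: \<V>_def)
      moreover have "A \<inter> V \<noteq> {}"
        using S(2) that(2) by simp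
      ultimately show False
        by (auto simp: A_def)
    qed
    have "S \<in> ?B"
      using S(1) C by (rule subsetD[rotated])
    moreover have "S \<notin> {?hit V |V. openin X V}"
      by (rule notI, elim CollectE exE conjE, rule no_hit)
    ultimately have "S \<in> {?miss W |W. openin X W \<and> compactin X (topspace X - W)}"
      by (simp only: Un_iff simp_thms)
    then obtain W where W: "S = ?miss W" "compactin X (topspace X - W)"
      by (elim CollectE exE conjE)
    have "topspace X - W \<subseteq> \<Union> \<V>"
      using S W by (auto simp: A_def)
    then obtain \<F> where \<F>: "finite \<F>" "\<F> \<subseteq> \<V>" "topspace X - W \<subseteq> \<Union> \<F>"
      using compactinD[OF W(2), of \<V>] by (auto simp: \<V>_def)
    have "carrier (CL X) \<subseteq> \<Union> (insert S (?hit ` \<F>))"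
    proof
      fix B assume B: "B \<in> carrier (CL X)"
      then have "B \<subseteq> topspace X"
        by (auto simp: CL_def dest: closedin_subset)
      then have "B \<subseteq> W \<or> (\<exists>V\<in>\<F>. B \<inter> V \<noteq> {})"
        using \<F>(3) by blast
      then show "B \<in> \<Union> (insert S (?hit ` \<F>))"
        using B by (simp add: W(1))
    qed
    moreover have "\<Union> (insert S (?hit ` \<F>)) \<subseteq> carrier (CL X)"
      by (auto simp: W(1))
    moreover have "insert S (?hit ` \<F>) \<subseteq> C"
      using S \<F>(2) by (auto simp: \<V>_def)
    ultimately show ?thesis
      unfolding UB using \<F>(1) by (intro exI[of _ "insert S (?hit ` \<F>)"] conjI equalityI) simp_all
  qed
  then show ?thesis
    unfolding fell_topology_def by (rule compact_space_topology_generated_by)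
qed

theorem proposition3p14:
  fixes X :: "'a topology"
  assumes "locally_compact_space X" and "Hausdorff_space X"
  shows "inverse_semigroup (CL X) \<and>
    inverse_semigroup (E_Gamma X) \<and>
    topologically_isomorphic
      (CL X) (fell_topology X)
      (E_Gamma X) (subtopology (tau_hco X) (idempotents (Homeo_Gamma X))) \<and>
    compactin (tau_hco X) (idempotents (Homeo_Gamma X))"
proof -
  have "compactin (tau_hco X) (hole_idempotent X ` topspace (fell_topology X))"
    using continuous_map_hole_idempotent_hco[OF assms(2)] compact_space_fell_topology
    by (meson compact_space_def image_compactin)
  then have "compactin (tau_hco X) (idempotents (Homeo_Gamma X))"
    using hole_idempotent_image[of X] by (simp add: topspace_fell_topology CL_def)
  then show ?thesis
    using inverse_semigroup_CL inverse_semigroup_E_Gamma hole_idempotent_iso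
      hole_idempotent_homeomorphic_map[OF assms(2)]
    unfolding topologically_isomorphic_def by blast
qed

end
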